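(* Let $(M,N)$ be a pair of nonempty, compact and convex subsets of a Fréchet smooth real Banach space $B$. Then the pair $(M_0,N_0)$ is nonempty, i.e. both $M_0\neq\emptyset$ and $N_0\ne\emptyset$.
   Context: $B$ is Fréchet smooth if its norm is Fréchet differentiable at every nonzero point (in particular $B$ is smooth). $J:B\to B^*$ is the (single-valued) normalized duality mapping: $\langle u,Ju\rangle=\|u\|^2=\|Ju\|^2$. Define $\phi(u,v)=\|u\|^2-2\langle u,Jv\rangle+\|v\|^2$, $\mathrm{dist}_\phi(M,N)=\inf\{\phi(u,v):u\in M,v\in N\}$, $M_0=\{u\in M:\phi(u,v)=\mathrm{dist}_\phi(M,N)\text{ for some }v\in N\}$ and $N_0=\{v\in N:\phi(u,v)=\mathrm{dist}_\phi(M,N)\text{ for some }u\in M\}$. *)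

theory Defs
  imports "HOL-Analysis.Analysis"
begin

text \<open>The topological dual of a real normed space \<open>'a\<close> is the type of bounded linear functionals
  \<open>'a \<Rightarrow>\<^sub>L real\<close> with the operator norm.\<close>

definition frechet_smooth :: "'a::real_normed_vector itself \<Rightarrow> bool" where
  "frechet_smooth _ \<longleftrightarrow> (\<forall>x::'a. x \<noteq> 0 \<longrightarrow> (norm :: 'a \<Rightarrow> real) differentiable (at x))"

definition is_duality_functional :: "'a::real_normed_vector \<Rightarrow> ('a \<Rightarrow>\<^sub>L real) \<Rightarrow> bool" where
  "is_duality_functional u f \<longleftrightarrow> blinfun_apply f u = (norm u)\<^sup>2 \<and> (norm f)\<^sup>2 = (norm u)\<^sup>2"

text \<open>The description operator is meaningful because the duality functional exists and is unique on
  a smooth space; see \<open>ex1_duality_functional\<close> below.\<close>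

definition duality_map :: "'a::real_normed_vector \<Rightarrow> ('a \<Rightarrow>\<^sub>L real)" where
  "duality_map u = (THE f. is_duality_functional u f)"

definition phi :: "'a::real_normed_vector \<Rightarrow> 'a \<Rightarrow> real" where
  "phi u v = (norm u)\<^sup>2 - 2 * blinfun_apply (duality_map v) u + (norm v)\<^sup>2"

definition dist_phi :: "'a::real_normed_vector set \<Rightarrow> 'a set \<Rightarrow> real" where
  "dist_phi M N = Inf {phi u v | u v. u \<in> M \<and> v \<in> N}"

definition proximal_fst :: "'a::real_normed_vector set \<Rightarrow> 'a set \<Rightarrow> 'a set" where
  "proximal_fst M N = {u \<in> M. \<exists>v \<in> N. phi u v = dist_phi M N}"

definition proximal_snd :: "'a::real_normed_vector set \<Rightarrow> 'a set \<Rightarrow> 'a set" where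
  "proximal_snd M N = {v \<in> N. \<exists>u \<in> M. phi u v = dist_phi M N}"

lemma ex1_duality_functional:
  fixes u :: "'a::real_normed_vector"
  assumes smooth: "frechet_smooth TYPE('a)"
  shows "\<exists>!f. is_duality_functional u f"
proof (cases "u = 0")
  case True
  then show ?thesis
    by (auto simp: is_duality_functional_def)
next
  case False
  then obtain D where D: "(norm has_derivative D) (at u)"
    using smooth by (auto simp: frechet_smooth_def differentiable_def)
  interpret D: bounded_linear D
    using D by (rule has_derivative_bounded_linear)
  have line: "((\<lambda>t. norm (u + t *\<^sub>R h)) has_real_derivative D h) (at 0)" for h
  proof -
    have "((\<lambda>t::real. u + t *\<^sub>R h) has_derivative (\<lambda>t. t *\<^sub>R h)) (at 0)"
      by (auto intro!: derivative_eq_intros)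
    moreover have "(norm has_derivative D) (at (u + 0 *\<^sub>R h))"
      using D by simp
    ultimately have "((\<lambda>t. norm (u + t *\<^sub>R h)) has_derivative (\<lambda>t. D (t *\<^sub>R h))) (at 0)"
      by (rule has_derivative_compose)
    then show ?thesis
      by (simp add: has_field_derivative_def D.scaleR mult_commute_abs)
  qed
  have unique: "blinfun_apply f h = norm u * D h" if "is_duality_functional u f" for f h
  proof -
    have fu: "blinfun_apply f u = (norm u)\<^sup>2" and nf: "norm f = norm u"
      using that by (auto simp: is_duality_functional_def)
    let ?g = "\<lambda>t. norm u * norm (u + t *\<^sub>R h) - ((norm u)\<^sup>2 + t * blinfun_apply f h)"
    have "(?g has_real_derivative norm u * D h - blinfun_apply f h) (at 0)"
      by (auto intro!: derivative_eq_intros line)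
    moreover have "?g 0 \<le> ?g t" for t
      using norm_blinfun[of f "u + t *\<^sub>R h"]
      by (simp add: fu nf blinfun.add_right blinfun.scaleR_right power2_eq_square)
    ultimately have "norm u * D h - blinfun_apply f h = 0"
      by (intro DERIV_local_min[of ?g _ 0 1]) auto
    then show ?thesis by simp
  qed
  have Du: "D u = norm u"
  proof -
    have "((\<lambda>t. (1 + t) * norm u) has_real_derivative norm u) (at 0)"
      by (auto intro!: derivative_eq_intros)
    then have "((\<lambda>t. norm (u + t *\<^sub>R u)) has_real_derivative norm u) (at 0)"
    proof (rule has_field_derivative_transform_within_open[where S = "{-1<..<1}"])
      fix t :: real assume "t \<in> {-1<..<1}"
      then show "(1 + t) * norm u = norm (u + t *\<^sub>R u)"
        by (metis abs_of_pos add.commute add_less_cancel_left add.right_inverse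
            greaterThanLessThan_iff norm_scaleR scaleR_add_left scaleR_one)
    qed auto
    with line[of u] show ?thesis by (rule DERIV_unique)
  qed
  have Dle: "\<bar>D h\<bar> \<le> norm h" for h
  proof -
    have "D h \<le> norm h" for h
    proof (rule ccontr)
      let ?g = "\<lambda>t. t * norm h - norm (u + t *\<^sub>R h)"
      assume "\<not> D h \<le> norm h"
      moreover have "(?g has_real_derivative norm h - D h) (at 0)"
        by (auto intro!: derivative_eq_intros line)
      ultimately obtain d where d: "d > 0" "\<And>t. t > 0 \<Longrightarrow> t < d \<Longrightarrow> ?g (0 + t) < ?g 0"
        using DERIV_neg_dec_right[of ?g "norm h - D h" 0] by auto
      from d(2)[of "d / 2"] d(1) norm_triangle_ineq[of u "(d / 2) *\<^sub>R h"] show False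
        by simp
    qed
    from this[of h] this[of "- h"] show ?thesis by (simp add: D.neg)
  qed
  define f where "f = norm u *\<^sub>R Blinfun D"
  have f: "blinfun_apply f h = norm u * D h" for h
    by (simp add: f_def blinfun.scaleR_left bounded_linear_Blinfun_apply D.bounded_linear_axioms)
  have "norm f \<le> norm u"
    by (rule norm_blinfun_bound) (auto simp: f abs_mult intro!: mult_left_mono Dle)
  moreover have "norm u \<le> norm f"
    using norm_blinfun[of f u] False by (simp add: f Du abs_mult)
  ultimately have "is_duality_functional u f"
    by (simp add: is_duality_functional_def f Du power2_eq_square)
  then show ?thesis
    by (rule ex1I) (auto intro!: blinfun_eqI simp: unique f)
qed

end

theory Submission imports Defs begin

text \<open>The squared norm is Frechet differentiable with derivative \<open>2 J v\<close> at \<open>v\<close>, and \<open>2 J w\<close> is a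
  subgradient of it at every \<open>w\<close>. Comparing the subgradient inequality at \<open>w\<close> with the first order
  expansion at \<open>v\<close> on a small sphere around \<open>v\<close> shows that \<open>J w \<longlongrightarrow> J v\<close> in norm as \<open>w \<longlongrightarrow> v\<close>. Hence
  \<open>phi\<close> is jointly continuous and attains its minimum on the compact set \<open>M \<times> N\<close>.\<close>

lemma is_duality_functional_duality_map:
  fixes u :: "'a::real_normed_vector"
  assumes "frechet_smooth TYPE('a)"
  shows "is_duality_functional u (duality_map u)"
  unfolding duality_map_def by (rule theI') (rule ex1_duality_functional[OF assms])

lemma duality_functional_apply_self:
  "is_duality_functional u f \<Longrightarrow> blinfun_apply f u = (norm u)\<^sup>2"
  by (simp add: is_duality_functional_def)

lemma norm_duality_functional:
  "is_duality_functional u f \<Longrightarrow> norm f = norm u"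
  by (auto simp: is_duality_functional_def)

text \<open>The operator norm bound followed by \<open>2ab <= a^2 + b^2\<close>. Since
  \<open>f u = (norm u)^2\<close>, this is the subgradient inequality for the squared norm at
  \<open>u\<close> with subgradient \<open>2 f\<close>, rearranged so that \<open>u\<close> enters
  only through its norm.\<close>

lemma duality_functional_le:
  assumes "is_duality_functional u f"
  shows "2 * blinfun_apply f y \<le> (norm u)\<^sup>2 + (norm y)\<^sup>2"
proof -
  have "blinfun_apply f y \<le> norm u * norm y"
    using norm_blinfun[of f y] norm_duality_functional[OF assms] by simp
  moreover have "2 * (norm u * norm y) \<le> (norm u)\<^sup>2 + (norm y)\<^sup>2"
    using sum_squares_bound[of "norm u" "norm y"] by simp
  ultimately show ?thesis by linarith
qed

text \<open>By the subgradient inequality, the squared norm minus \<open>2 f\<close> has a global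
  minimum at \<open>u\<close>, so its derivative there vanishes.\<close>

lemma norm_power2_has_derivative_duality_functional:
  fixes u :: "'a::real_normed_vector"
  assumes smooth: "frechet_smooth TYPE('a)" and "u \<noteq> 0" and f: "is_duality_functional u f"
  shows "((\<lambda>x. (norm x)\<^sup>2) has_derivative (\<lambda>h. 2 * blinfun_apply f h)) (at u)"
proof -
  obtain D where D: "(norm has_derivative D) (at u)"
    using smooth \<open>u \<noteq> 0\<close> by (auto simp: frechet_smooth_def differentiable_def)
  have sq: "((\<lambda>x. (norm x)\<^sup>2) has_derivative (\<lambda>h. 2 * norm u * D h)) (at u)"
    using has_derivative_power[OF D, of 2] by (simp add: mult_ac)
  have "((\<lambda>x. (norm x)\<^sup>2 - 2 * blinfun_apply f x) has_derivative
      (\<lambda>h. 2 * norm u * D h - 2 * blinfun_apply f h)) (at u)"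
    by (intro has_derivative_diff[OF sq] has_derivative_mult_right
        bounded_linear_imp_has_derivative blinfun.bounded_linear_right)
  moreover have "(norm u)\<^sup>2 - 2 * blinfun_apply f u \<le> (norm x)\<^sup>2 - 2 * blinfun_apply f x" for x
    using duality_functional_le[OF f, of x] duality_functional_apply_self[OF f] by simp
  ultimately have "(\<lambda>h. 2 * norm u * D h - 2 * blinfun_apply f h) = (\<lambda>h. 0)"
    by (intro differential_zero_maxmin[where S = UNIV and x = u]) auto
  then have "(\<lambda>h. 2 * norm u * D h) = (\<lambda>h. 2 * blinfun_apply f h)"
    by (simp add: fun_eq_iff)
  with sq show ?thesis by simp
qed

text \<open>Homogeneity carries the bound from the sphere to all vectors; replacing \<open>x\<close>
  by \<open>- x\<close> turns the one-sided bound into a two-sided one.\<close>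

lemma norm_blinfun_le_on_sphere:
  fixes f :: "'a::real_normed_vector \<Rightarrow>\<^sub>L real"
  assumes "d > 0" "c \<ge> 0" and le: "\<And>h. norm h = d \<Longrightarrow> blinfun_apply f h \<le> c * d"
  shows "norm f \<le> c"
proof (rule norm_blinfun_bound[OF \<open>c \<ge> 0\<close>])
  fix x
  have *: "blinfun_apply f y \<le> c * norm y" for y
  proof (cases "y = 0")
    case False
    have "blinfun_apply f ((d / norm y) *\<^sub>R y) \<le> c * d"
      by (rule le) (use False \<open>d > 0\<close> in simp)
    with False \<open>d > 0\<close> show ?thesis
      by (simp add: blinfun.scaleR_right field_simps)
  qed simp
  from *[of x] *[of "- x"] show "norm (blinfun_apply f x) \<le> c * norm x"
    by (simp add: blinfun.minus_right)
qed

lemma isCont_duality_map: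
  fixes v :: "'a::real_normed_vector"
  assumes smooth: "frechet_smooth TYPE('a)"
  shows "isCont duality_map v"
proof (cases "v = 0")
  case True
  \<comment> \<open>The derivative lemma covers only nonzero points; at the origin continuity
    follows because \<open>duality_map\<close> preserves norms.\<close>
  have norm_J: "norm (duality_map w) = norm w" for w :: 'a
    by (rule norm_duality_functional) (rule is_duality_functional_duality_map[OF smooth])
  then have "duality_map v = 0"
    using True by (metis norm_zero norm_eq_zero)
  moreover have "(duality_map \<longlongrightarrow> 0) (at v)"
    using True by (subst tendsto_norm_zero_iff[symmetric])
      (auto simp: norm_J intro!: tendsto_norm_zero)
  ultimately show ?thesis
    by (simp add: isCont_def)
next
  case False
  let ?f = "duality_map v"
  note dual = is_duality_functional_duality_map[OF smooth]
  \<comment> \<open>\<open>r w\<close> is the error from using the subgradient at \<open>w\<close>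
    in place of \<open>v\<close>: the gap between the squared norms, plus twice the bound on
    \<open>?g (w - v)\<close> from \<open>gv\<close> below.\<close>
  define r where "r w = (norm v)\<^sup>2 - (norm w)\<^sup>2 + 2 * (norm w * norm (w - v))" for w
  have r_lim: "(r \<longlongrightarrow> 0) (at v)"
    unfolding r_def by (auto intro!: tendsto_eq_intros)
  show ?thesis
    unfolding isCont_def tendsto_iff
  proof (intro allI impI)
    fix e :: real assume "e > 0"
    obtain d0 where "d0 > 0" and d0: "\<And>y. norm (y - v) < d0 \<Longrightarrow>
        norm ((norm y)\<^sup>2 - (norm v)\<^sup>2 - 2 * blinfun_apply ?f (y - v)) \<le> e / 2 * norm (y - v)"
      using norm_power2_has_derivative_duality_functional[OF smooth False dual] \<open>e > 0\<close>
      unfolding has_derivative_at_alt by (meson half_gt_zero)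
    \<comment> \<open>Halving puts the whole sphere of radius \<open>d\<close> around
      \<open>v\<close> inside the open ball where the expansion holds.\<close>
    define d where "d = d0 / 2"
    have d: "d > 0" "d < d0" using \<open>d0 > 0\<close> by (auto simp: d_def)
    have "\<forall>\<^sub>F w in at v. r w < e / 2 * d"
      by (rule order_tendstoD(2)[OF r_lim]) (use \<open>e > 0\<close> d in simp)
    then show "\<forall>\<^sub>F w in at v. dist (duality_map w) ?f < e"
    proof (rule eventually_mono)
      fix w assume w: "r w < e / 2 * d"
      let ?g = "duality_map w"
      have gv: "(norm w)\<^sup>2 - norm w * norm (w - v) \<le> blinfun_apply ?g v"
        using norm_blinfun[of ?g "w - v"] norm_duality_functional[OF dual, of w]
          duality_functional_apply_self[OF dual, of w]
        by (simp add: blinfun.diff_right)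
      have "norm (?g - ?f) \<le> e / 2"
      proof (rule norm_blinfun_le_on_sphere[OF d(1)])
        fix h :: 'a assume h: "norm h = d"
        have "\<bar>(norm (v + h))\<^sup>2 - (norm v)\<^sup>2 - 2 * blinfun_apply ?f h\<bar> \<le> e / 2 * d"
          using d0[of "v + h"] h d by simp
        then have "(norm (v + h))\<^sup>2 \<le> (norm v)\<^sup>2 + 2 * blinfun_apply ?f h + e / 2 * d"
          by linarith
        moreover have "2 * blinfun_apply ?g (v + h) \<le> (norm w)\<^sup>2 + (norm (v + h))\<^sup>2"
          by (rule duality_functional_le[OF dual])
        \<comment> \<open>Together these bound \<open>2 * (?g - ?f) h\<close> by \<open>r w\<close>
          plus the expansion error, each at most \<open>e / 2 * d\<close>.\<close>
        ultimately show "blinfun_apply (?g - ?f) h \<le> e / 2 * d"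
          using gv w by (simp add: r_def blinfun.add_right blinfun.diff_left)
      qed (use \<open>e > 0\<close> in simp)
      then show "dist ?g ?f < e"
        using \<open>e > 0\<close> by (simp add: dist_norm)
    qed
  qed
qed

text \<open>Evaluation of functionals is bounded bilinear, so norm continuity of
  \<open>duality_map\<close> makes the pairing jointly continuous.\<close>

lemma continuous_on_phi:
  assumes "frechet_smooth TYPE('a::real_normed_vector)"
  shows "continuous_on S (\<lambda>(u::'a, v). phi u v)"
proof -
  have "continuous_on UNIV (duality_map :: 'a \<Rightarrow> _)"
    by (simp add: continuous_at_imp_continuous_on isCont_duality_map[OF assms])
  then have "continuous_on S (\<lambda>p::'a \<times> 'a. duality_map (snd p))"
    by (rule continuous_on_compose2) (auto intro!: continuous_intros)
  then show ?thesis
    unfolding phi_def case_prod_beta by (intro continuous_intros)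
qed

theorem proposition2p9:
  fixes M N :: "'a::banach set"
  assumes smooth: "frechet_smooth TYPE('a)"
    and M: "M \<noteq> {}" "compact M" "convex M"
    and N: "N \<noteq> {}" "compact N" "convex N"
  shows "proximal_fst M N \<noteq> {} \<and> proximal_snd M N \<noteq> {}"
proof -
  have "\<exists>p\<in>M \<times> N. \<forall>q\<in>M \<times> N. (\<lambda>(u, v). phi u v) p \<le> (\<lambda>(u, v). phi u v) q"
    by (rule continuous_attains_inf)
      (use M N in \<open>auto intro: compact_Times continuous_on_phi[OF smooth]\<close>)
  then obtain u v where uv: "u \<in> M" "v \<in> N"
    and min: "\<And>x y. x \<in> M \<Longrightarrow> y \<in> N \<Longrightarrow> phi u v \<le> phi x y"
    by auto
  \<comment> \<open>The infimum is attained at one pair, whose components witness each other's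
    membership in the two proximal sets.\<close>
  have "dist_phi M N = phi u v"
    unfolding dist_phi_def by (rule cInf_eq_minimum) (use uv min in auto)
  with uv show ?thesis
    by (auto simp: proximal_fst_def proximal_snd_def)
qed

end
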